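(* For every positive integer $q$, the presentation $$\mathcal G_q=\langle x,y\mid x=x^{-1}y^{-1}xy,\ y=y^{-1}x^{-q}yx^{q}\rangle$$ satisfies the Andrews--Curtis conjecture, i.e. $\mathcal G_q$ can be transformed into the empty presentation $\langle\ \mid\ \rangle$ by a finite sequence of $Q^{**}$-transformations.
   Context: A relation $u=v$ stands for the relator $uv^{-1}$. The $Q^{**}$-transformations of a finite presentation $\langle x_1,\dots,x_n\mid r_1,\dots,r_m\rangle$ are: (1) replace some $r_i$ by $r_i^{-1}$; (2) replace some $r_i$ by $r_ir_j$ with $j\neq i$; (3) replace some $r_i$ by $wr_iw^{-1}$ with $w$ in the free group $F(x_1,\dots,x_n)$; (4) add a generator $x_{n+1}$ and a relator $r_{m+1}=x_{n+1}$, or the inverse of this operation; (5) replace every $r_i$ by $\phi(r_i)$ for an automorphism $\phi$ of $F(x_1,\dots,x_n)$. *)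

theory Defs
  imports "HOL-Algebra.Group"
begin

text \<open>
  The free group on \<open>x\<^sub>0, \<dots>, x\<^bsub>n-1\<^esub>\<close> is realised as the set of freely reduced words.
  The letter \<open>(False, i)\<close> is \<open>x\<^sub>i\<close> and \<open>(True, i)\<close> is its inverse.  Thus the free group of
  rank \<open>n\<close> is literally a subset of the free group of rank \<open>n + 1\<close>.
\<close>

type_synonym letter = "bool \<times> nat"
type_synonym word = "letter list"

definition inv_letter :: "letter \<Rightarrow> letter" where
  "inv_letter a = (\<not> fst a, snd a)"

definition reduced :: "word \<Rightarrow> bool" where
  "reduced w \<longleftrightarrow> successively (\<lambda>a b. b \<noteq> inv_letter a) w"

fun red_cons :: "letter \<Rightarrow> word \<Rightarrow> word" where
  "red_cons a [] = [a]"
| "red_cons a (b # w) = (if b = inv_letter a then w else a # b # w)"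

definition reduce :: "word \<Rightarrow> word" where
  "reduce w = foldr red_cons w []"

definition free_group :: "nat \<Rightarrow> word monoid" where
  "free_group n =
     \<lparr>carrier = {w. reduced w \<and> snd ` set w \<subseteq> {..<n}},
      mult = (\<lambda>u v. reduce (u @ v)),
      one = []\<rparr>"

definition gen :: "nat \<Rightarrow> word" where
  "gen i = [(False, i)]"

lemma inv_letter_inv_letter [simp]: "inv_letter (inv_letter a) = a"
  by (simp add: inv_letter_def)

lemma snd_inv_letter [simp]: "snd (inv_letter a) = snd a"
  by (simp add: inv_letter_def)

lemma reduce_Nil [simp]: "reduce [] = []"
  and reduce_Cons [simp]: "reduce (a # w) = red_cons a (reduce w)"
  by (simp_all add: reduce_def)

lemma reduced_red_cons: "reduced w \<Longrightarrow> reduced (red_cons a w)"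
  by (cases w) (auto simp: reduced_def successively_Cons)

lemma reduced_reduce: "reduced (reduce w)"
  by (induction w) (auto simp: reduced_red_cons, simp add: reduced_def)

lemma reduce_reduced: "reduced w \<Longrightarrow> reduce w = w"
proof (induction w)
  case (Cons a w)
  then show ?case by (cases w) (auto simp: reduced_def)
qed simp

lemma red_cons_cancel: "reduced w \<Longrightarrow> red_cons (inv_letter a) (red_cons a w) = w"
proof (cases w)
  case (Cons b v)
  assume "reduced w"
  then show ?thesis using Cons by (cases v) (auto simp: reduced_def)
qed simp

lemma red_cons_cancel': "reduced w \<Longrightarrow> red_cons a (red_cons (inv_letter a) w) = w"
  using red_cons_cancel[of w "inv_letter a"] by simp

lemma reduce_append_right: "reduce (u @ reduce v) = reduce (u @ v)"
  by (induction u) (auto simp: reduce_reduced reduced_reduce)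

lemma reduce_red_cons_append: "reduce (red_cons a w @ v) = red_cons a (reduce (w @ v))"
  by (cases w) (auto simp: red_cons_cancel' reduced_reduce)

lemma reduce_append_left: "reduce (reduce u @ v) = reduce (u @ v)"
  by (induction u) (auto simp: reduce_red_cons_append)

lemma set_red_cons: "set (red_cons a w) \<subseteq> insert a (set w)"
  by (cases w) auto

lemma set_reduce: "set (reduce w) \<subseteq> set w"
proof (induction w)
  case (Cons a w)
  then show ?case using set_red_cons[of a "reduce w"] by auto
qed simp

lemma reduce_inverse: "reduce (rev (map inv_letter w) @ w) = []"
proof (induction w)
  case (Cons a w)
  have "reduce (rev (map inv_letter (a # w)) @ (a # w)) =
        reduce (rev (map inv_letter w) @ reduce (inv_letter a # a # w))"
    by (simp add: reduce_append_right del: reduce_Cons)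
  also have "\<dots> = reduce (rev (map inv_letter w) @ w)"
    by (simp add: red_cons_cancel reduced_reduce reduce_append_right)
  finally show ?case using Cons by simp
qed simp

lemma group_free_group: "group (free_group n)"
proof (rule groupI)
  show "\<one>\<^bsub>free_group n\<^esub> \<in> carrier (free_group n)"
    by (simp add: free_group_def reduced_def)
  fix u assume u: "u \<in> carrier (free_group n)"
  then show "\<one>\<^bsub>free_group n\<^esub> \<otimes>\<^bsub>free_group n\<^esub> u = u"
    by (simp add: free_group_def reduce_reduced)
  let ?u = "reduce (rev (map inv_letter u))"
  have "set ?u \<subseteq> inv_letter ` set u"
    using set_reduce[of "rev (map inv_letter u)"] by simp
  then have "?u \<in> carrier (free_group n)"
    using u by (fastforce simp: free_group_def reduced_reduce)
  moreover have "?u \<otimes>\<^bsub>free_group n\<^esub> u = \<one>\<^bsub>free_group n\<^esub>"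
    by (simp add: free_group_def reduce_append_left reduce_inverse)
  ultimately show "\<exists>v\<in>carrier (free_group n). v \<otimes>\<^bsub>free_group n\<^esub> u = \<one>\<^bsub>free_group n\<^esub>"
    by blast
  fix v assume v: "v \<in> carrier (free_group n)"
  show "u \<otimes>\<^bsub>free_group n\<^esub> v \<in> carrier (free_group n)"
    using u v set_reduce[of "u @ v"] by (fastforce simp: free_group_def reduced_reduce)
  fix w assume "w \<in> carrier (free_group n)"
  show "u \<otimes>\<^bsub>free_group n\<^esub> v \<otimes>\<^bsub>free_group n\<^esub> w =
        u \<otimes>\<^bsub>free_group n\<^esub> (v \<otimes>\<^bsub>free_group n\<^esub> w)"
    by (simp add: free_group_def reduce_append_left reduce_append_right)
qed

lemma gen_in_free_group: "i < n \<Longrightarrow> gen i \<in> carrier (free_group n)"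
  by (simp add: gen_def free_group_def reduced_def)

definition eval_letter :: "('a, 'b) monoid_scheme \<Rightarrow> (nat \<Rightarrow> 'a) \<Rightarrow> letter \<Rightarrow> 'a" where
  "eval_letter G f a = (if fst a then inv\<^bsub>G\<^esub> f (snd a) else f (snd a))"

definition eval_word :: "('a, 'b) monoid_scheme \<Rightarrow> (nat \<Rightarrow> 'a) \<Rightarrow> word \<Rightarrow> 'a" where
  "eval_word G f w = foldr (\<lambda>a g. eval_letter G f a \<otimes>\<^bsub>G\<^esub> g) w \<one>\<^bsub>G\<^esub>"

lemma eval_word_simps [simp]:
  "eval_word G f [] = \<one>\<^bsub>G\<^esub>"
  "eval_word G f (a # w) = eval_letter G f a \<otimes>\<^bsub>G\<^esub> eval_word G f w"
  by (simp_all add: eval_word_def)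

text \<open>
  These two lemmas justify the encoding by reduced words: \<open>free_group n\<close> has the universal
  property of the free group on \<open>gen 0, \<dots>, gen (n - 1)\<close>.
\<close>

lemma (in group) free_group_extend:
  assumes f: "\<And>i. i < n \<Longrightarrow> f i \<in> carrier G"
  shows "eval_word G f \<in> hom (free_group n) G"
    and "i < n \<Longrightarrow> eval_word G f (gen i) = f i"
proof -
  have letter: "eval_letter G f a \<in> carrier G" if "snd a < n" for a
    using f that by (simp add: eval_letter_def)
  have closed: "eval_word G f w \<in> carrier G" if "snd ` set w \<subseteq> {..<n}" for w
    using that by (induction w) (auto simp: letter)
  have red_cons: "eval_word G f (red_cons a w) = eval_letter G f a \<otimes> eval_word G f w"
    if "snd a < n" "snd ` set w \<subseteq> {..<n}" for a w
  proof (cases "\<exists>v. w = inv_letter a # v")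
    case True
    then obtain v where w: "w = inv_letter a # v" by blast
    have "eval_letter G f a \<otimes> eval_letter G f (inv_letter a) = \<one>"
      using f that(1) by (auto simp: eval_letter_def inv_letter_def)
    then show ?thesis
      using that w letter[of a] letter[of "inv_letter a"] closed[of v]
      by (simp add: m_assoc[symmetric])
  next
    case False
    then show ?thesis by (cases w) auto
  qed
  have reduce: "eval_word G f (reduce w) = eval_word G f w" if "snd ` set w \<subseteq> {..<n}" for w
    using that
  proof (induction w)
    case (Cons a w)
    have "snd ` set (reduce w) \<subseteq> {..<n}" using set_reduce[of w] Cons.prems by auto
    then show ?case using Cons by (simp add: red_cons)
  qed simp
  have append: "eval_word G f (u @ v) = eval_word G f u \<otimes> eval_word G f v"
    if "snd ` set u \<subseteq> {..<n}" "snd ` set v \<subseteq> {..<n}" for u v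
    using that by (induction u) (auto simp: closed letter m_assoc)
  show "eval_word G f \<in> hom (free_group n) G"
    by (rule homI) (auto simp: free_group_def closed reduce append image_Un)
  show "i < n \<Longrightarrow> eval_word G f (gen i) = f i"
    using f by (simp add: gen_def eval_letter_def)
qed

lemma (in group) free_group_hom_unique:
  assumes h: "h \<in> hom (free_group n) G" and k: "k \<in> hom (free_group n) G"
    and eq: "\<And>i. i < n \<Longrightarrow> h (gen i) = k (gen i)"
    and w: "w \<in> carrier (free_group n)"
  shows "h w = k w"
proof -
  let ?F = "free_group n"
  interpret F: group ?F by (rule group_free_group)
  interpret h: group_hom ?F G h by unfold_locales (rule h)
  interpret k: group_hom ?F G k by unfold_locales (rule k)
  have inv_gen: "[(True, i)] = inv\<^bsub>?F\<^esub> gen i" if "i < n" for i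
  proof (rule F.inv_equality[symmetric])
    show "[(True, i)] \<in> carrier ?F" using that by (simp add: free_group_def reduced_def)
    show "[(True, i)] \<otimes>\<^bsub>?F\<^esub> gen i = \<one>\<^bsub>?F\<^esub>"
      by (simp add: free_group_def gen_def inv_letter_def)
  qed (simp add: gen_in_free_group that)
  have letter: "[a] \<in> carrier ?F \<and> h [a] = k [a]" if "snd a < n" for a
  proof (cases a)
    case (Pair b i)
    then show ?thesis
      using that inv_gen[of i] eq[of i] gen_in_free_group[of i n]
      by (cases b) (auto simp: gen_def[symmetric])
  qed
  show ?thesis using w
  proof (induction w)
    case Nil
    have "[] = \<one>\<^bsub>?F\<^esub>" by (simp add: free_group_def)
    then show ?case by (metis h.hom_one k.hom_one)
  next
    case (Cons a w)
    have w: "w \<in> carrier ?F" and a: "snd a < n"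
      using Cons.prems by (auto simp: free_group_def reduced_def successively_Cons)
    have "a # w = reduce (a # w)"
      using Cons.prems by (simp add: free_group_def reduce_reduced del: reduce_Cons)
    then have "a # w = [a] \<otimes>\<^bsub>?F\<^esub> w" by (simp add: free_group_def)
    then show ?case using Cons.IH[OF w] letter[OF a] w by (metis h.hom_mult k.hom_mult)
  qed
qed

text \<open>
  A finite presentation is given by its number of generators and its list of relators, which are
  elements of the free group on these generators.
\<close>

type_synonym presentation = "nat \<times> word list"

definition is_presentation :: "presentation \<Rightarrow> bool" where
  "is_presentation P \<longleftrightarrow> set (snd P) \<subseteq> carrier (free_group (fst P))"

definition relation :: "nat \<Rightarrow> word \<Rightarrow> word \<Rightarrow> word" where
  "relation n u v = u \<otimes>\<^bsub>free_group n\<^esub> inv\<^bsub>free_group n\<^esub> v"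

definition empty_presentation :: presentation where
  "empty_presentation = (0, [])"

text \<open>
  A single \<open>Q\<^sup>*\<^sup>*\<close>-transformation.  As indices start at 0, the generator added to a presentation
  with \<open>n\<close> generators is \<open>gen n\<close>.
\<close>

inductive Qss_step :: "presentation \<Rightarrow> presentation \<Rightarrow> bool" where
  invert:
    "\<lbrakk>is_presentation (n, rs); i < length rs\<rbrakk>
     \<Longrightarrow> Qss_step (n, rs) (n, rs[i := inv\<^bsub>free_group n\<^esub> (rs ! i)])"
| multiply:
    "\<lbrakk>is_presentation (n, rs); i < length rs; j < length rs; j \<noteq> i\<rbrakk>
     \<Longrightarrow> Qss_step (n, rs) (n, rs[i := rs ! i \<otimes>\<^bsub>free_group n\<^esub> rs ! j])"
| conjugate:
    "\<lbrakk>is_presentation (n, rs); i < length rs; w \<in> carrier (free_group n)\<rbrakk>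
     \<Longrightarrow> Qss_step (n, rs)
           (n, rs[i := w \<otimes>\<^bsub>free_group n\<^esub> rs ! i \<otimes>\<^bsub>free_group n\<^esub> inv\<^bsub>free_group n\<^esub> w])"
| stabilize:
    "is_presentation (n, rs) \<Longrightarrow> Qss_step (n, rs) (Suc n, rs @ [gen n])"
| destabilize:
    "is_presentation (n, rs) \<Longrightarrow> Qss_step (Suc n, rs @ [gen n]) (n, rs)"
| automorphism:
    "\<lbrakk>is_presentation (n, rs); \<phi> \<in> iso (free_group n) (free_group n)\<rbrakk>
     \<Longrightarrow> Qss_step (n, rs) (n, map \<phi> rs)"

definition satisfies_Andrews_Curtis :: "presentation \<Rightarrow> bool" where
  "satisfies_Andrews_Curtis P \<longleftrightarrow> Qss_step\<^sup>*\<^sup>* P empty_presentation"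

definition presentation_G :: "nat \<Rightarrow> presentation" where
  "presentation_G q =
     (let F = free_group 2; x = gen 0; y = gen 1 in
      (2, [relation 2 x (inv\<^bsub>F\<^esub> x \<otimes>\<^bsub>F\<^esub> inv\<^bsub>F\<^esub> y \<otimes>\<^bsub>F\<^esub> x \<otimes>\<^bsub>F\<^esub> y),
           relation 2 y (inv\<^bsub>F\<^esub> y \<otimes>\<^bsub>F\<^esub> inv\<^bsub>F\<^esub> (x [^]\<^bsub>F\<^esub> q) \<otimes>\<^bsub>F\<^esub> y \<otimes>\<^bsub>F\<^esub> (x [^]\<^bsub>F\<^esub> q))]))"

lemma is_presentation_G: "is_presentation (presentation_G q)"
proof -
  interpret F: group "free_group 2" by (rule group_free_group)
  show ?thesis
    by (simp add: presentation_G_def is_presentation_def relation_def Let_def gen_in_free_group)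
qed

lemma Qss_step_is_presentation:
  assumes "Qss_step P P'"
  shows "is_presentation P'"
  using assms
proof cases
  case (invert n rs i)
  interpret F: group "free_group n" by (rule group_free_group)
  have "rs ! i \<in> carrier (free_group n)" using invert by (auto simp: is_presentation_def)
  then show ?thesis
    using invert set_update_subset_insert[of rs i] by (fastforce simp: is_presentation_def)
next
  case (multiply n rs i j)
  interpret F: group "free_group n" by (rule group_free_group)
  have "rs ! i \<in> carrier (free_group n)" "rs ! j \<in> carrier (free_group n)"
    using multiply by (auto simp: is_presentation_def)
  then show ?thesis
    using multiply set_update_subset_insert[of rs i] by (fastforce simp: is_presentation_def)
next
  case (conjugate n rs i w)
  interpret F: group "free_group n" by (rule group_free_group)
  have "rs ! i \<in> carrier (free_group n)" using conjugate by (auto simp: is_presentation_def)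
  then show ?thesis
    using conjugate set_update_subset_insert[of rs i] by (fastforce simp: is_presentation_def)
next
  case (stabilize n rs)
  have "carrier (free_group n) \<subseteq> carrier (free_group (Suc n))"
    by (auto simp: free_group_def)
  then show ?thesis
    using stabilize gen_in_free_group[of n "Suc n"] by (auto simp: is_presentation_def)
next
  case (automorphism n rs \<phi>)
  then show ?thesis by (auto simp: is_presentation_def iso_def hom_def)
qed (auto simp: is_presentation_def)

end

theory Submission imports Defs "HOL-Algebra.Coset" begin

text \<open>
  A relator may be replaced by any word that represents the same element modulo the normal closure
  of the other relators: the factors of a product of conjugates of \<open>r\<^sub>j\<^sup>\<plusminus>\<^sup>1\<close> can be attached one
  after the other.  This is \<open>Qss_replace_relator\<close>, and it reduces the theorem to three
  computations in groups in which one of the two relators holds.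

  The relation \<open>x = x\<^sup>-\<^sup>1 y\<^sup>-\<^sup>1 x y\<close> says \<open>y\<^sup>-\<^sup>1 x y = x\<^sup>2\<close>, whence \<open>y\<^sup>-\<^sup>1 x\<^sup>q y = x\<^sup>2\<^sup>q\<close>.  The second
  relator is \<open>y x\<^sup>-\<^sup>q (y\<^sup>-\<^sup>1 x\<^sup>q y)\<close>, so modulo the first one it equals \<open>y x\<^sup>q\<close>.  But once \<open>y\<close> is a
  power of \<open>x\<close>, the two commute, and the first relator collapses to \<open>x\<close>.  Modulo \<open>x\<close>, finally,
  \<open>y x\<^sup>q\<close> is \<open>y\<close>.  The relators are now the generators, which two destabilizations remove.
\<close>

section \<open>Replacing a relator modulo the others\<close>

text \<open>
  Asking for all \<open>s\<close> at once, and not only for the current \<open>i\<close>-th relator, is what makes this set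
  a normal subgroup.
\<close>

definition absorbed :: "nat \<Rightarrow> word list \<Rightarrow> nat \<Rightarrow> word set" where
  "absorbed n rs i =
     {u \<in> carrier (free_group n). \<forall>s \<in> carrier (free_group n).
        Qss_step\<^sup>*\<^sup>* (n, rs[i := s]) (n, rs[i := s \<otimes>\<^bsub>free_group n\<^esub> u])}"

lemma is_presentation_update:
  assumes "is_presentation (n, rs)" "s \<in> carrier (free_group n)"
  shows "is_presentation (n, rs[i := s])"
  using assms set_update_subset_insert[of rs i s] by (fastforce simp: is_presentation_def)

context
  fixes n :: nat and rs :: "word list" and i :: nat and F
  assumes pres: "is_presentation (n, rs)" and i: "i < length rs"
  defines "F \<equiv> free_group n"
begin

interpretation F: group F
  unfolding F_def by (rule group_free_group)

lemma Qss_invert_at: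
  assumes "s \<in> carrier F"
  shows "Qss_step (n, rs[i := s]) (n, rs[i := inv\<^bsub>F\<^esub> s])"
  using Qss_step.invert[of n "rs[i := s]" i] is_presentation_update[OF pres] assms i
  by (simp add: F_def)

lemma Qss_conjugate_at:
  assumes "s \<in> carrier F" "w \<in> carrier F"
  shows "Qss_step (n, rs[i := s]) (n, rs[i := w \<otimes>\<^bsub>F\<^esub> s \<otimes>\<^bsub>F\<^esub> inv\<^bsub>F\<^esub> w])"
  using Qss_step.conjugate[of n "rs[i := s]" i w] is_presentation_update[OF pres] assms i
  by (simp add: F_def)

lemma absorbedD:
  assumes "u \<in> absorbed n rs i" "s \<in> carrier F"
  shows "Qss_step\<^sup>*\<^sup>* (n, rs[i := s]) (n, rs[i := s \<otimes>\<^bsub>F\<^esub> u])"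
  using assms by (simp add: absorbed_def F_def)

lemma absorbedI:
  assumes "u \<in> carrier F"
    and "\<And>s. s \<in> carrier F \<Longrightarrow> Qss_step\<^sup>*\<^sup>* (n, rs[i := s]) (n, rs[i := s \<otimes>\<^bsub>F\<^esub> u])"
  shows "u \<in> absorbed n rs i"
  using assms by (simp add: absorbed_def F_def)

lemma absorbed_closed: "u \<in> absorbed n rs i \<Longrightarrow> u \<in> carrier F"
  by (simp add: absorbed_def F_def)

lemma other_relator_absorbed:
  assumes "j < length rs" "j \<noteq> i"
  shows "rs ! j \<in> absorbed n rs i"
proof (rule absorbedI)
  show "rs ! j \<in> carrier F"
    using pres assms by (auto simp: is_presentation_def F_def)
  show "Qss_step\<^sup>*\<^sup>* (n, rs[i := s]) (n, rs[i := s \<otimes>\<^bsub>F\<^esub> rs ! j])" if "s \<in> carrier F" for s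
    using Qss_step.multiply[of n "rs[i := s]" i j] is_presentation_update[OF pres] that assms i
    by (simp add: F_def r_into_rtranclp)
qed

text \<open>
  A right factor \<open>u\<^sup>-\<^sup>1\<close> is obtained by attaching \<open>u\<close> to the inverse relator, inverting, and
  moving the resulting left factor \<open>u\<^sup>-\<^sup>1\<close> to the right by conjugation; a right factor
  \<open>g u g\<^sup>-\<^sup>1\<close> by attaching \<open>u\<close> between conjugations with \<open>g\<^sup>-\<^sup>1\<close> and \<open>g\<close>.
\<close>

lemma absorbed_normal: "absorbed n rs i \<lhd> F"
proof (subst F.normal_inv_iff, intro conjI ballI)
  show "subgroup (absorbed n rs i) F"
  proof (rule F.subgroupI)
    show "absorbed n rs i \<subseteq> carrier F"
      using absorbed_closed by blast
    have "\<one>\<^bsub>F\<^esub> \<in> absorbed n rs i"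
      by (rule absorbedI) auto
    then show "absorbed n rs i \<noteq> {}"
      by blast
  next
    fix u assume u: "u \<in> absorbed n rs i"
    note uF = absorbed_closed[OF u]
    show "inv\<^bsub>F\<^esub> u \<in> absorbed n rs i"
    proof (rule absorbedI)
      fix s assume s: "s \<in> carrier F"
      have "Qss_step\<^sup>*\<^sup>* (n, rs[i := s]) (n, rs[i := inv\<^bsub>F\<^esub> s \<otimes>\<^bsub>F\<^esub> u])"
        using Qss_invert_at[OF s] absorbedD[OF u, of "inv\<^bsub>F\<^esub> s"] s by simp
      also have "Qss_step\<^sup>*\<^sup>* \<dots> (n, rs[i := inv\<^bsub>F\<^esub> u \<otimes>\<^bsub>F\<^esub> s])"
        using Qss_invert_at[of "inv\<^bsub>F\<^esub> s \<otimes>\<^bsub>F\<^esub> u"] s uF by (simp add: F.inv_mult_group r_into_rtranclp)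
      also have "Qss_step\<^sup>*\<^sup>* \<dots> (n, rs[i := s \<otimes>\<^bsub>F\<^esub> inv\<^bsub>F\<^esub> u])"
        using Qss_conjugate_at[of "inv\<^bsub>F\<^esub> u \<otimes>\<^bsub>F\<^esub> s" u] s uF
        by (simp add: F.m_assoc[symmetric] r_into_rtranclp)
      finally show "Qss_step\<^sup>*\<^sup>* (n, rs[i := s]) (n, rs[i := s \<otimes>\<^bsub>F\<^esub> inv\<^bsub>F\<^esub> u])" .
    qed (use uF in simp)
  next
    fix u v assume u: "u \<in> absorbed n rs i" and v: "v \<in> absorbed n rs i"
    note uF = absorbed_closed[OF u] and vF = absorbed_closed[OF v]
    show "u \<otimes>\<^bsub>F\<^esub> v \<in> absorbed n rs i"
    proof (rule absorbedI)
      fix s assume s: "s \<in> carrier F"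
      show "Qss_step\<^sup>*\<^sup>* (n, rs[i := s]) (n, rs[i := s \<otimes>\<^bsub>F\<^esub> (u \<otimes>\<^bsub>F\<^esub> v)])"
        using rtranclp_trans[OF absorbedD[OF u s] absorbedD[OF v, of "s \<otimes>\<^bsub>F\<^esub> u"]] s uF vF
        by (simp add: F.m_assoc)
    qed (use uF vF in simp)
  qed
next
  fix g u assume g: "g \<in> carrier F" and u: "u \<in> absorbed n rs i"
  note uF = absorbed_closed[OF u]
  show "g \<otimes>\<^bsub>F\<^esub> u \<otimes>\<^bsub>F\<^esub> inv\<^bsub>F\<^esub> g \<in> absorbed n rs i"
  proof (rule absorbedI)
    fix s assume s: "s \<in> carrier F"
    let ?t = "inv\<^bsub>F\<^esub> g \<otimes>\<^bsub>F\<^esub> s \<otimes>\<^bsub>F\<^esub> g"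
    have "Qss_step\<^sup>*\<^sup>* (n, rs[i := s]) (n, rs[i := ?t])"
      using Qss_conjugate_at[OF s, of "inv\<^bsub>F\<^esub> g"] g by (simp add: r_into_rtranclp)
    also have "Qss_step\<^sup>*\<^sup>* \<dots> (n, rs[i := ?t \<otimes>\<^bsub>F\<^esub> u])"
      by (rule absorbedD[OF u]) (use s g in simp)
    also have "Qss_step\<^sup>*\<^sup>* \<dots> (n, rs[i := s \<otimes>\<^bsub>F\<^esub> (g \<otimes>\<^bsub>F\<^esub> u \<otimes>\<^bsub>F\<^esub> inv\<^bsub>F\<^esub> g)])"
      using Qss_conjugate_at[of "?t \<otimes>\<^bsub>F\<^esub> u" g] s g uF
      by (simp add: F.m_assoc[symmetric] r_into_rtranclp)
    finally show "Qss_step\<^sup>*\<^sup>* (n, rs[i := s])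
        (n, rs[i := s \<otimes>\<^bsub>F\<^esub> (g \<otimes>\<^bsub>F\<^esub> u \<otimes>\<^bsub>F\<^esub> inv\<^bsub>F\<^esub> g)])" .
  qed (use g uF in simp)
qed

text \<open>
  Equality modulo the normal closure of the other relators is expressed through homomorphisms that
  kill them, so that it can be checked by computing in a group.  The one homomorphism that the proof
  needs is the projection modulo the absorbed words; its values are cosets, whence the type
  \<^typ>\<open>word set\<close>.
\<close>

lemma Qss_replace_relator:
  assumes s': "s' \<in> carrier F"
    and eq: "\<And>(G :: word set monoid) h. \<lbrakk>group_hom F G h;
        \<And>j. \<lbrakk>j < length rs; j \<noteq> i\<rbrakk> \<Longrightarrow> h (rs ! j) = \<one>\<^bsub>G\<^esub>\<rbrakk> \<Longrightarrow> h (rs ! i) = h s'"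
  shows "Qss_step\<^sup>*\<^sup>* (n, rs) (n, rs[i := s'])"
proof -
  let ?N = "absorbed n rs i" and ?s = "rs ! i"
  let ?\<pi> = "\<lambda>u. ?N #>\<^bsub>F\<^esub> u"
  interpret N: normal ?N F by (rule absorbed_normal)
  interpret \<pi>: group_hom F "F Mod ?N" ?\<pi>
    by (simp add: group_hom_def group_hom_axioms_def F.is_group N.factorgroup_is_group
        N.r_coset_hom_Mod)
  have s: "?s \<in> carrier F"
    using pres i by (auto simp: is_presentation_def F_def)
  have "?\<pi> (rs ! j) = \<one>\<^bsub>F Mod ?N\<^esub>" if "j < length rs" "j \<noteq> i" for j
    using other_relator_absorbed[OF that] absorbed_closed
    by (simp add: N.rcos_const)
  then have "?\<pi> ?s = ?\<pi> s'"
    by (rule eq[OF \<pi>.group_hom_axioms])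
  then have "?\<pi> (inv\<^bsub>F\<^esub> ?s \<otimes>\<^bsub>F\<^esub> s') = \<one>\<^bsub>F Mod ?N\<^esub>"
    using s s' by (simp only: \<pi>.hom_mult \<pi>.hom_inv F.inv_closed \<pi>.hom_closed \<pi>.H.l_inv)
  then have "?N #>\<^bsub>F\<^esub> (inv\<^bsub>F\<^esub> ?s \<otimes>\<^bsub>F\<^esub> s') = ?N"
    by (simp only: one_FactGroup)
  then have "inv\<^bsub>F\<^esub> ?s \<otimes>\<^bsub>F\<^esub> s' \<in> ?N"
    by (rule F.coset_join1) (use s s' N.subgroup_axioms in auto)
  from absorbedD[OF this s] show ?thesis
    using s s' by (simp add: F.m_assoc[symmetric])
qed

end

section \<open>The relators in a group where one of them holds\<close>

lemma (in group) cancel_inv: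
  assumes "x \<in> carrier G" "z \<in> carrier G"
  shows "inv x \<otimes> (x \<otimes> z) = z" and "x \<otimes> (inv x \<otimes> z) = z"
  using assms by (simp_all flip: m_assoc)

lemma (in group) conjugate_pow:
  assumes "x \<in> carrier G" "y \<in> carrier G"
  shows "(inv y \<otimes> x \<otimes> y) [^] (q::nat) = inv y \<otimes> x [^] q \<otimes> y"
proof (induction q)
  case (Suc q)
  then show ?case
    using assms by (simp add: m_assoc cancel_inv)
qed (use assms in simp)

text \<open>
  The hypothesis says that conjugation by \<open>y\<close> squares \<open>x\<close>, hence also \<open>x\<^sup>q\<close>; one of the two factors
  \<open>x\<^sup>q\<close> arising in this way cancels against \<open>x\<^sup>-\<^sup>q\<close> in the second relator.
\<close>

lemma (in group) second_relator_modulo_first: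
  assumes x: "x \<in> carrier G" and y: "y \<in> carrier G"
    and rel: "x \<otimes> inv (inv x \<otimes> inv y \<otimes> x \<otimes> y) = \<one>"
  shows "y \<otimes> inv (inv y \<otimes> inv (x [^] q) \<otimes> y \<otimes> x [^] (q::nat)) = y \<otimes> x [^] q"
proof -
  have "x = inv x \<otimes> inv y \<otimes> x \<otimes> y"
    using rel x y by (metis inv_closed inv_equality inv_inv m_closed)
  then have "x \<otimes> x = x \<otimes> (inv x \<otimes> (inv y \<otimes> x \<otimes> y))"
    using x y by (simp add: m_assoc)
  then have "inv y \<otimes> x \<otimes> y = x \<otimes> x"
    using x y by (simp add: m_assoc[symmetric])
  then have conj: "inv y \<otimes> x [^] q \<otimes> y = x [^] q \<otimes> x [^] q"
    using x y conjugate_pow[of x y q] by (simp add: pow_mult_distrib)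
  have "y \<otimes> inv (inv y \<otimes> inv (x [^] q) \<otimes> y \<otimes> x [^] q)
      = y \<otimes> inv (x [^] q) \<otimes> (inv y \<otimes> x [^] q \<otimes> y)"
    using x y by (simp add: inv_mult_group m_assoc)
  also have "\<dots> = y \<otimes> x [^] q"
    unfolding conj using x y by (simp add: m_assoc cancel_inv)
  finally show ?thesis .
qed

text \<open>
  By hypothesis \<open>y = x\<^sup>-\<^sup>q\<close> commutes with \<open>x\<close>, so the commutator of the two disappears from the relator.
\<close>

lemma (in group) first_relator_if_power:
  assumes x: "x \<in> carrier G" and y: "y \<in> carrier G" and rel: "y \<otimes> x [^] (q::nat) = \<one>"
  shows "x \<otimes> inv (inv x \<otimes> inv y \<otimes> x \<otimes> y) = x"
proof -
  have y_eq: "y = inv (x [^] q)"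
    using rel x y by (simp add: inv_equality)
  have "x \<otimes> x [^] q = x [^] q \<otimes> x"
    using x nat_pow_comm[of x 1 q] by simp
  then have "inv y \<otimes> x \<otimes> y = x \<otimes> x [^] q \<otimes> inv (x [^] q)"
    using x by (simp add: y_eq)
  then have "inv y \<otimes> x \<otimes> y = x"
    using x by (simp add: m_assoc)
  then have "inv x \<otimes> inv y \<otimes> x \<otimes> y = \<one>"
    using x y by (simp add: m_assoc)
  then show ?thesis
    using x by simp
qed

section \<open>Trivializing the presentation\<close>

theorem theorem3p5:
  fixes q :: nat
  assumes "q > 0"
  shows "satisfies_Andrews_Curtis (presentation_G q)"
proof -
  define F where "F = free_group 2"
  define x y where "x = gen 0" and "y = gen 1"
  define r\<^sub>1 where "r\<^sub>1 = relation 2 x (inv\<^bsub>F\<^esub> x \<otimes>\<^bsub>F\<^esub> inv\<^bsub>F\<^esub> y \<otimes>\<^bsub>F\<^esub> x \<otimes>\<^bsub>F\<^esub> y)"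
  define r\<^sub>2 where
    "r\<^sub>2 = relation 2 y (inv\<^bsub>F\<^esub> y \<otimes>\<^bsub>F\<^esub> inv\<^bsub>F\<^esub> (x [^]\<^bsub>F\<^esub> q) \<otimes>\<^bsub>F\<^esub> y \<otimes>\<^bsub>F\<^esub> (x [^]\<^bsub>F\<^esub> q))"
  let ?yxq = "y \<otimes>\<^bsub>F\<^esub> x [^]\<^bsub>F\<^esub> q"
  interpret F: group F
    unfolding F_def by (rule group_free_group)
  have x: "x \<in> carrier F" and y: "y \<in> carrier F"
    by (simp_all add: F_def x_def y_def gen_in_free_group)
  have r\<^sub>1: "r\<^sub>1 \<in> carrier F" and r\<^sub>2: "r\<^sub>2 \<in> carrier F"
    using x y by (simp_all add: r\<^sub>1_def r\<^sub>2_def relation_def flip: F_def)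
  have pres: "is_presentation (2, [u, v])" if "u \<in> carrier F" "v \<in> carrier F" for u v
    using that by (simp add: is_presentation_def F_def)
  have replace\<^sub>1: "Qss_step\<^sup>*\<^sup>* (2, [u, v]) (2, [u', v])"
    if "u \<in> carrier F" "u' \<in> carrier F" "v \<in> carrier F"
      and "\<And>(G :: word set monoid) h. \<lbrakk>group_hom F G h; h v = \<one>\<^bsub>G\<^esub>\<rbrakk> \<Longrightarrow> h u = h u'" for u u' v
  proof -
    have "Qss_step\<^sup>*\<^sup>* (2, [u, v]) (2, [u, v][0 := u'])"
    proof (rule Qss_replace_relator[OF pres], fold F_def)
      fix G :: "word set monoid" and h
      assume h: "group_hom F G h"
        and others: "\<And>j. \<lbrakk>j < length [u, v]; j \<noteq> 0\<rbrakk> \<Longrightarrow> h ([u, v] ! j) = \<one>\<^bsub>G\<^esub>"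
      show "h ([u, v] ! 0) = h u'"
        using that(4)[OF h] others[of 1] by simp
    qed (use that(1-3) in simp_all)
    then show ?thesis
      by simp
  qed
  have replace\<^sub>2: "Qss_step\<^sup>*\<^sup>* (2, [u, v]) (2, [u, v'])"
    if "u \<in> carrier F" "v \<in> carrier F" "v' \<in> carrier F"
      and "\<And>(G :: word set monoid) h. \<lbrakk>group_hom F G h; h u = \<one>\<^bsub>G\<^esub>\<rbrakk> \<Longrightarrow> h v = h v'" for u v v'
  proof -
    have "Qss_step\<^sup>*\<^sup>* (2, [u, v]) (2, [u, v][1 := v'])"
    proof (rule Qss_replace_relator[OF pres], fold F_def)
      fix G :: "word set monoid" and h
      assume h: "group_hom F G h"
        and others: "\<And>j. \<lbrakk>j < length [u, v]; j \<noteq> 1\<rbrakk> \<Longrightarrow> h ([u, v] ! j) = \<one>\<^bsub>G\<^esub>"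
      show "h ([u, v] ! 1) = h v'"
        using that(4)[OF h] others[of 0] by simp
    qed (use that(1-3) in simp_all)
    then show ?thesis
      by simp
  qed
  have h_r\<^sub>1: "h r\<^sub>1 = h x \<otimes>\<^bsub>G\<^esub> inv\<^bsub>G\<^esub> (inv\<^bsub>G\<^esub> h x \<otimes>\<^bsub>G\<^esub> inv\<^bsub>G\<^esub> h y \<otimes>\<^bsub>G\<^esub> h x \<otimes>\<^bsub>G\<^esub> h y)"
    and h_r\<^sub>2: "h r\<^sub>2 = h y \<otimes>\<^bsub>G\<^esub>
      inv\<^bsub>G\<^esub> (inv\<^bsub>G\<^esub> h y \<otimes>\<^bsub>G\<^esub> inv\<^bsub>G\<^esub> (h x [^]\<^bsub>G\<^esub> q) \<otimes>\<^bsub>G\<^esub> h y \<otimes>\<^bsub>G\<^esub> (h x [^]\<^bsub>G\<^esub> q))"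
    and h_yxq: "h ?yxq = h y \<otimes>\<^bsub>G\<^esub> h x [^]\<^bsub>G\<^esub> q"
    and h_closed: "h x \<in> carrier G" "h y \<in> carrier G"
    and h_group: "group G"
    if "group_hom F G h" for G :: "word set monoid" and h
  proof -
    interpret h: group_hom F G h by (rule that)
    have pow: "h (x [^]\<^bsub>F\<^esub> q) = h x [^]\<^bsub>G\<^esub> q"
      using x by (rule h.hom_nat_pow)
    show "h r\<^sub>1 = h x \<otimes>\<^bsub>G\<^esub> inv\<^bsub>G\<^esub> (inv\<^bsub>G\<^esub> h x \<otimes>\<^bsub>G\<^esub> inv\<^bsub>G\<^esub> h y \<otimes>\<^bsub>G\<^esub> h x \<otimes>\<^bsub>G\<^esub> h y)"
      using x y by (simp add: r\<^sub>1_def relation_def flip: F_def)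
    show "h r\<^sub>2 = h y \<otimes>\<^bsub>G\<^esub>
      inv\<^bsub>G\<^esub> (inv\<^bsub>G\<^esub> h y \<otimes>\<^bsub>G\<^esub> inv\<^bsub>G\<^esub> (h x [^]\<^bsub>G\<^esub> q) \<otimes>\<^bsub>G\<^esub> h y \<otimes>\<^bsub>G\<^esub> (h x [^]\<^bsub>G\<^esub> q))"
      using x y by (simp add: r\<^sub>2_def relation_def pow flip: F_def)
    show "h ?yxq = h y \<otimes>\<^bsub>G\<^esub> h x [^]\<^bsub>G\<^esub> q"
      using x y by (simp add: pow)
    show "h x \<in> carrier G" "h y \<in> carrier G" "group G"
      using x y by simp_all
  qed
  have "Qss_step\<^sup>*\<^sup>* (2, [r\<^sub>1, r\<^sub>2]) (2, [r\<^sub>1, ?yxq])"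
  proof (rule replace\<^sub>2)
    fix G :: "word set monoid" and h
    assume h: "group_hom F G h" and "h r\<^sub>1 = \<one>\<^bsub>G\<^esub>"
    then show "h r\<^sub>2 = h ?yxq"
      using group.second_relator_modulo_first[OF h_group h_closed, OF h h h]
      by (simp add: h_r\<^sub>1[OF h] h_r\<^sub>2[OF h] h_yxq[OF h])
  qed (use x y r\<^sub>1 r\<^sub>2 in simp_all)
  also have "Qss_step\<^sup>*\<^sup>* \<dots> (2, [x, ?yxq])"
  proof (rule replace\<^sub>1)
    fix G :: "word set monoid" and h
    assume h: "group_hom F G h" and "h ?yxq = \<one>\<^bsub>G\<^esub>"
    then show "h r\<^sub>1 = h x"
      using group.first_relator_if_power[OF h_group h_closed, OF h h h]
      by (simp add: h_r\<^sub>1[OF h] h_yxq[OF h])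
  qed (use x y r\<^sub>1 in simp_all)
  also have "Qss_step\<^sup>*\<^sup>* \<dots> (2, [x, y])"
  proof (rule replace\<^sub>2)
    fix G :: "word set monoid" and h
    assume h: "group_hom F G h" and hx: "h x = \<one>\<^bsub>G\<^esub>"
    interpret G: group G by (rule h_group[OF h])
    show "h ?yxq = h y"
      using h_closed[OF h] by (simp add: h_yxq[OF h] hx)
  qed (use x y in simp_all)
  also have "Qss_step (2, [x, y]) (1, [x])"
    using Qss_step.destabilize[of 1 "[x]"]
    by (simp add: x_def y_def is_presentation_def gen_in_free_group numeral_2_eq_2)
  also have "Qss_step (1, [x]) (0, [])"
    using Qss_step.destabilize[of 0 "[]"] by (simp add: x_def is_presentation_def)
  finally show ?thesis
    by (simp add: satisfies_Andrews_Curtis_def presentation_G_def empty_presentation_def Let_def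
        r\<^sub>1_def r\<^sub>2_def x_def y_def F_def)
qed

end
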